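(* Let $f$ be a function with a Lipschitz continuous gradient over $\mathbb{R}^n$, let $L>0$, and consider the following conditions: [0] $\|\nabla f(x)-\nabla f(y)\|\le L\|x-y\|$ for all $x,y$. [1] $g(x)=\frac L2x^Tx-f(x)$ is convex. [2] $f(y)\le f(x)+\nabla f(x)^T(y-x)+\frac L2\|y-x\|^2$ for all $x,y$. [3] $(\nabla f(x)-\nabla f(y))^T(x-y)\le L\|x-y\|^2$ for all $x,y$. [4] $f(\alpha x+(1-\alpha)y)\ge\alpha f(x)+(1-\alpha)f(y)-\frac{\alpha(1-\alpha)L}{2}\|x-y\|^2$ for all $x,y$ and $\alpha\in[0,1]$. [5] $f(y)\ge f(x)+\nabla f(x)^T(y-x)+\frac{1}{2L}\|\nabla f(y)-\nabla f(x)\|^2$ for all $x,y$. [6] $(\nabla f(x)-\nabla f(y))^T(x-y)\ge\frac1L\|\nabla f(x)-\nabla f(y)\|^2$ for all $x,y$. [7] $f(\alpha x+(1-\alpha)y)\le\alpha f(x)+(1-\alpha)f(y)-\frac{\alpha(1-\alpha)}{2L}\|\nabla f(x)-\nabla f(y)\|^2$ for all $x,y$ and $\alpha\in[0,1]$. Then $$[5]\iff[7]\implies[6]\implies[0]\implies[1]\iff[2]\iff[3]\iff[4].$$ If moreover $f$ is convex, then all the conditions [0]–[7] are equivalent.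
   Context: All $x,y$ range over $\mathbb{R}^n$ and $\|\cdot\|$ is the Euclidean norm. A function with a Lipschitz continuous gradient over $\mathbb{R}^n$ is a differentiable $f:\mathbb{R}^n\to\mathbb{R}$ whose gradient is Lipschitz continuous for some constant (not required to be the $L$ in the listed conditions). *)

theory Defs
  imports "HOL-Analysis.Analysis"
begin

(* In all definitions below, G stands for the gradient map of f. *)

definition lipschitz_gradient :: "real \<Rightarrow> (real^'n \<Rightarrow> real^'n) \<Rightarrow> bool" where
  "lipschitz_gradient L G \<longleftrightarrow>
    (\<forall>x y. norm (G x - G y) \<le> L * norm (x - y))"

definition convex_quadratic_minus :: "real \<Rightarrow> (real^'n \<Rightarrow> real) \<Rightarrow> bool" where
  "convex_quadratic_minus L f \<longleftrightarrow>
    convex_on UNIV (\<lambda>x. L / 2 * (x \<bullet> x) - f x)"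

definition quadratic_upper_bound ::
    "real \<Rightarrow> (real^'n \<Rightarrow> real) \<Rightarrow> (real^'n \<Rightarrow> real^'n) \<Rightarrow> bool" where
  "quadratic_upper_bound L f G \<longleftrightarrow>
    (\<forall>x y. f y \<le> f x + G x \<bullet> (y - x) + L / 2 * (norm (y - x))\<^sup>2)"

definition gradient_monotone_upper :: "real \<Rightarrow> (real^'n \<Rightarrow> real^'n) \<Rightarrow> bool" where
  "gradient_monotone_upper L G \<longleftrightarrow>
    (\<forall>x y. (G x - G y) \<bullet> (x - y) \<le> L * (norm (x - y))\<^sup>2)"

definition jensen_lower :: "real \<Rightarrow> (real^'n \<Rightarrow> real) \<Rightarrow> bool" where
  "jensen_lower L f \<longleftrightarrow>
    (\<forall>x y. \<forall>\<alpha>\<in>{0..1}.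
      f (\<alpha> *\<^sub>R x + (1 - \<alpha>) *\<^sub>R y)
        \<ge> \<alpha> * f x + (1 - \<alpha>) * f y - \<alpha> * (1 - \<alpha>) * L / 2 * (norm (x - y))\<^sup>2)"

definition gradient_lower_bound ::
    "real \<Rightarrow> (real^'n \<Rightarrow> real) \<Rightarrow> (real^'n \<Rightarrow> real^'n) \<Rightarrow> bool" where
  "gradient_lower_bound L f G \<longleftrightarrow>
    (\<forall>x y. f y \<ge> f x + G x \<bullet> (y - x) + 1 / (2 * L) * (norm (G y - G x))\<^sup>2)"

definition gradient_cocoercive :: "real \<Rightarrow> (real^'n \<Rightarrow> real^'n) \<Rightarrow> bool" where
  "gradient_cocoercive L G \<longleftrightarrow>
    (\<forall>x y. (G x - G y) \<bullet> (x - y) \<ge> 1 / L * (norm (G x - G y))\<^sup>2)"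

definition jensen_upper ::
    "real \<Rightarrow> (real^'n \<Rightarrow> real) \<Rightarrow> (real^'n \<Rightarrow> real^'n) \<Rightarrow> bool" where
  "jensen_upper L f G \<longleftrightarrow>
    (\<forall>x y. \<forall>\<alpha>\<in>{0..1}.
      f (\<alpha> *\<^sub>R x + (1 - \<alpha>) *\<^sub>R y)
        \<le> \<alpha> * f x + (1 - \<alpha>) * f y
          - \<alpha> * (1 - \<alpha>) / (2 * L) * (norm (G x - G y))\<^sup>2)"

end

theory Submission
  imports Defs
begin

text \<open>
  Everything rests on the fact that three descriptions of a differentiable function \<open>h\<close> agree:
  \<open>h\<close> satisfies Jensen's inequality, \<open>h\<close> lies above its tangent planes, and the gradient of \<open>h\<close>
  is monotone.  Applied to \<open>h x = L / 2 * (x \<bullet> x) - f x\<close>, whose gradient is \<open>L x - \<nabla>f x\<close>, these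
  are the convexity of \<open>h\<close>, the quadratic upper bound on \<open>f\<close> and the bound
  \<open>(\<nabla>f x - \<nabla>f y) \<bullet> (x - y) \<le> L \<parallel>x - y\<parallel>\<^sup>2\<close>; the quadratic part of \<open>h\<close> turns the convexity of
  \<open>h\<close> into the lower Jensen inequality for \<open>f\<close> because the Jensen gap of \<open>\<parallel>\<cdot>\<parallel>\<^sup>2\<close> is exactly
  \<open>\<alpha> (1 - \<alpha>) \<parallel>x - y\<parallel>\<^sup>2\<close> (\<open>norm_sq_convex_combination\<close>).

  The equivalence of Jensen's inequality and the tangent inequality survives when a multiple of
  \<open>\<parallel>\<nabla>f x - \<nabla>f y\<parallel>\<^sup>2\<close> is added to both as a reserve (\<open>tangent_iff_jensen\<close>): without reserve it
  characterises convexity, and with factor \<open>1 / (2 L)\<close> it is the equivalence of the gradient lower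
  bound and the upper Jensen inequality.  Summing the lower bound over \<open>(x, y)\<close> and \<open>(y, x)\<close> gives
  cocoercivity, and Cauchy-Schwarz leads from there to the Lipschitz condition and on to the
  monotonicity bound.

  For convex \<open>f\<close> the circle is closed by going from the quadratic upper bound to the gradient lower
  bound (\<open>gradient_lower_bound_if_convex\<close>): the tangent plane at \<open>x\<close> and the paraboloid at \<open>y\<close>
  enclose \<open>f\<close>, and comparing them at the point where they are closest yields the squared gradient
  difference.
\<close>

section \<open>Restriction to lines\<close>

lemma GDERIV_imp_DERIV_line:
  fixes f :: "'a::real_inner \<Rightarrow> real"
  assumes "GDERIV f (x + t *\<^sub>R v) :> D"
  shows "((\<lambda>t. f (x + t *\<^sub>R v)) has_real_derivative D \<bullet> v) (at t)"
proof -
  have "((\<lambda>t. x + t *\<^sub>R v) has_derivative (\<lambda>s. s *\<^sub>R v)) (at t)"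
    by (auto intro!: derivative_eq_intros)
  moreover have "(f has_derivative (\<lambda>h. h \<bullet> D)) (at (x + t *\<^sub>R v))"
    using assms by (simp add: gderiv_def)
  ultimately have "((\<lambda>t. f (x + t *\<^sub>R v)) has_derivative (\<lambda>s. (s *\<^sub>R v) \<bullet> D)) (at t)"
    by (rule has_derivative_compose)
  moreover have "(\<lambda>s. (s *\<^sub>R v) \<bullet> D) = (*) (D \<bullet> v)"
    by (simp add: fun_eq_iff inner_commute)
  ultimately show ?thesis
    by (simp add: has_field_derivative_def)
qed

text \<open>Divide the assumed bound by \<open>t\<close> and let \<open>t\<close> tend to \<open>0\<close> from the right.  The term \<open>t * c\<close>
  vanishes in the limit; it accommodates a Jensen inequality with a correction of the form
  \<open>t (1 - t) c\<close>.\<close>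

lemma directional_derivative_le:
  fixes f :: "'a::real_inner \<Rightarrow> real"
  assumes "GDERIV f x :> D"
    and chord: "\<And>t. \<lbrakk>0 < t; t < 1\<rbrakk> \<Longrightarrow> f (x + t *\<^sub>R v) \<le> f x + t * (b + t * c)"
  shows "D \<bullet> v \<le> b"
proof -
  have "((\<lambda>t. f (x + t *\<^sub>R v)) has_real_derivative D \<bullet> v) (at 0)"
    using assms(1) by (intro GDERIV_imp_DERIV_line) simp
  then have "((\<lambda>t. (f (x + t *\<^sub>R v) - f x) / t) \<longlongrightarrow> D \<bullet> v) (at_right 0)"
    by (auto simp: DERIV_def intro: filterlim_at_split[THEN iffD1, THEN conjunct2])
  moreover have "((\<lambda>t. b + t * c) \<longlongrightarrow> b + 0 * c) (at_right 0)"
    by (intro tendsto_intros)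
  moreover have "\<forall>\<^sub>F t in at_right 0. (f (x + t *\<^sub>R v) - f x) / t \<le> b + t * c"
    unfolding eventually_at_right_field
    using chord by (intro exI[of _ 1]) (force simp: field_simps)
  ultimately show ?thesis
    using tendsto_le[OF trivial_limit_at_right_real] by fastforce
qed

section \<open>Jensen inequalities, tangent inequalities and monotone gradients\<close>

lemma norm_sq_convex_combination:
  fixes x y :: "'a::real_inner"
  shows "(norm (\<alpha> *\<^sub>R x + (1 - \<alpha>) *\<^sub>R y))\<^sup>2
    = \<alpha> * (norm x)\<^sup>2 + (1 - \<alpha>) * (norm y)\<^sup>2 - \<alpha> * (1 - \<alpha>) * (norm (x - y))\<^sup>2"
  unfolding power2_norm_eq_inner
  by (simp add: inner_add inner_diff inner_commute[of y x] algebra_simps)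

text \<open>From left to right, average the tangent inequalities based at the intermediate point
  \<open>z = \<alpha> x + (1 - \<alpha>) y\<close> and evaluated at \<open>x\<close> and \<open>y\<close>: the linear terms cancel, and the averaged
  squared distances from \<open>G z\<close> to \<open>G x\<close> and \<open>G y\<close> are at least their variance
  \<open>\<alpha> (1 - \<alpha>) \<parallel>G x - G y\<parallel>\<^sup>2\<close>.  From right to left, differentiate the Jensen inequality at the
  endpoint \<open>\<alpha> = 0\<close>.\<close>

lemma tangent_iff_jensen:
  fixes f :: "'a::real_inner \<Rightarrow> real"
  assumes gradient: "\<And>x. GDERIV f x :> G x" and "c \<ge> 0"
  shows "(\<forall>x y. f y \<ge> f x + G x \<bullet> (y - x) + c * (norm (G y - G x))\<^sup>2) \<longleftrightarrow>
    (\<forall>x y. \<forall>\<alpha>\<in>{0..1}. f (\<alpha> *\<^sub>R x + (1 - \<alpha>) *\<^sub>R y)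
      \<le> \<alpha> * f x + (1 - \<alpha>) * f y - \<alpha> * (1 - \<alpha>) * c * (norm (G x - G y))\<^sup>2)"
    (is "?tangent \<longleftrightarrow> ?jensen")
proof
  assume tangent: ?tangent
  show ?jensen
  proof (intro allI ballI)
    fix x y :: 'a and \<alpha> :: real
    assume \<alpha>: "\<alpha> \<in> {0..1}"
    define z where "z = \<alpha> *\<^sub>R x + (1 - \<alpha>) *\<^sub>R y"
    define a where "a = G x - G z"
    define b where "b = G y - G z"
    have "\<alpha> * (f z + G z \<bullet> (x - z) + c * (norm a)\<^sup>2) \<le> \<alpha> * f x"
      using \<alpha> tangent by (intro mult_left_mono) (auto simp: a_def)
    moreover have "(1 - \<alpha>) * (f z + G z \<bullet> (y - z) + c * (norm b)\<^sup>2) \<le> (1 - \<alpha>) * f y"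
      using \<alpha> tangent by (intro mult_left_mono) (auto simp: b_def)
    moreover have "\<alpha> * (G z \<bullet> (x - z)) + (1 - \<alpha>) * (G z \<bullet> (y - z)) = 0"
    proof -
      have "\<alpha> *\<^sub>R (x - z) + (1 - \<alpha>) *\<^sub>R (y - z) = 0"
        by (simp add: z_def algebra_simps)
      from arg_cong[OF this, of "\<lambda>v. G z \<bullet> v"] show ?thesis
        by (simp add: inner_add_right)
    qed
    moreover have "c * (\<alpha> * (norm a)\<^sup>2 + (1 - \<alpha>) * (norm b)\<^sup>2)
        \<ge> c * (\<alpha> * (1 - \<alpha>) * (norm (G x - G y))\<^sup>2)"
    proof (rule mult_left_mono[OF _ \<open>c \<ge> 0\<close>])
      have "G x - G y = a - b"
        by (simp add: a_def b_def)
      then show "\<alpha> * (1 - \<alpha>) * (norm (G x - G y))\<^sup>2 \<le> \<alpha> * (norm a)\<^sup>2 + (1 - \<alpha>) * (norm b)\<^sup>2"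
        using norm_sq_convex_combination[of \<alpha> a b] zero_le_power2[of "norm (\<alpha> *\<^sub>R a + (1 - \<alpha>) *\<^sub>R b)"]
        by simp
    qed
    ultimately show "f (\<alpha> *\<^sub>R x + (1 - \<alpha>) *\<^sub>R y)
      \<le> \<alpha> * f x + (1 - \<alpha>) * f y - \<alpha> * (1 - \<alpha>) * c * (norm (G x - G y))\<^sup>2"
      unfolding z_def[symmetric] by (simp add: algebra_simps)
  qed
next
  assume jensen: ?jensen
  show ?tangent
  proof (intro allI)
    fix x y
    let ?r = "c * (norm (G y - G x))\<^sup>2"
    have "G x \<bullet> (y - x) \<le> f y - f x - ?r"
    proof (rule directional_derivative_le[OF gradient])
      fix t :: real
      assume "0 < t" "t < 1"
      moreover have "x + t *\<^sub>R (y - x) = t *\<^sub>R y + (1 - t) *\<^sub>R x"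
        by (simp add: algebra_simps)
      ultimately show "f (x + t *\<^sub>R (y - x)) \<le> f x + t * ((f y - f x - ?r) + t * ?r)"
        using jensen[rule_format, of t y x] by (simp add: algebra_simps)
    qed
    then show "f y \<ge> f x + G x \<bullet> (y - x) + ?r"
      by simp
  qed
qed

lemma convex_on_UNIV_iff:
  fixes h :: "'a::real_vector \<Rightarrow> real"
  shows "convex_on UNIV h \<longleftrightarrow> (\<forall>x y. \<forall>\<alpha>\<in>{0..1}.
    h (\<alpha> *\<^sub>R x + (1 - \<alpha>) *\<^sub>R y) \<le> \<alpha> * h x + (1 - \<alpha>) * h y)" (is "_ \<longleftrightarrow> ?jensen")
proof
  assume "convex_on UNIV h"
  then show ?jensen
    by (simp add: convex_on_def)
next
  assume jensen: ?jensen
  show "convex_on UNIV h"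
    unfolding convex_on_def
  proof (intro conjI ballI allI impI)
    fix x y :: 'a and u v :: real
    assume "0 \<le> u" "0 \<le> v" "u + v = 1"
    then have "v = 1 - u" "u \<in> {0..1}"
      by auto
    with jensen show "h (u *\<^sub>R x + v *\<^sub>R y) \<le> u * h x + v * h y"
      by blast
  qed simp
qed

corollary convex_on_iff_tangent:
  fixes h :: "'a::real_inner \<Rightarrow> real"
  assumes "\<And>x. GDERIV h x :> H x"
  shows "convex_on UNIV h \<longleftrightarrow> (\<forall>x y. h y \<ge> h x + H x \<bullet> (y - x))"
  using tangent_iff_jensen[of h H 0] assms by (simp add: convex_on_UNIV_iff)

text \<open>Monotonicity is the sum of two tangent inequalities.  Conversely, by the mean value theorem
  the increment \<open>h y - h x\<close> is a directional derivative at a point between \<open>x\<close> and \<open>y\<close>, and a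
  monotone gradient has increased there in the direction \<open>y - x\<close>.\<close>

lemma tangent_iff_gradient_monotone:
  fixes h :: "'a::real_inner \<Rightarrow> real"
  assumes gradient: "\<And>x. GDERIV h x :> H x"
  shows "(\<forall>x y. h y \<ge> h x + H x \<bullet> (y - x)) \<longleftrightarrow> (\<forall>x y. (H x - H y) \<bullet> (x - y) \<ge> 0)"
    (is "?tangent \<longleftrightarrow> ?monotone")
proof
  assume tangent: ?tangent
  show ?monotone
  proof (intro allI)
    fix x y
    show "(H x - H y) \<bullet> (x - y) \<ge> 0"
      using tangent[rule_format, of x y] tangent[rule_format, of y x]
      by (simp add: inner_diff)
  qed
next
  assume monotone: ?monotone
  show ?tangent
  proof (intro allI)
    fix x y
    obtain \<xi> :: real where \<xi>: "0 < \<xi>"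
      and increment: "h (x + 1 *\<^sub>R (y - x)) - h (x + 0 *\<^sub>R (y - x))
        = (1 - 0) * (H (x + \<xi> *\<^sub>R (y - x)) \<bullet> (y - x))"
      using MVT2[of 0 1 "\<lambda>t. h (x + t *\<^sub>R (y - x))" "\<lambda>t. H (x + t *\<^sub>R (y - x)) \<bullet> (y - x)"]
        GDERIV_imp_DERIV_line[OF gradient] by auto
    have "\<xi> * ((H (x + \<xi> *\<^sub>R (y - x)) - H x) \<bullet> (y - x)) \<ge> 0"
      using monotone[rule_format, of "x + \<xi> *\<^sub>R (y - x)" x] by simp
    with \<xi> have "(H (x + \<xi> *\<^sub>R (y - x)) - H x) \<bullet> (y - x) \<ge> 0"
      by (simp add: zero_le_mult_iff)
    with increment show "h y \<ge> h x + H x \<bullet> (y - x)"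
      by (simp add: inner_diff_left)
  qed
qed

section \<open>Upper bounds on the curvature\<close>

lemma GDERIV_quadratic_minus:
  fixes f :: "'a::real_inner \<Rightarrow> real"
  assumes "GDERIV f x :> D"
  shows "GDERIV (\<lambda>x. L / 2 * (x \<bullet> x) - f x) x :> L *\<^sub>R x - D"
proof -
  have "(f has_derivative (\<lambda>h. h \<bullet> D)) (at x)"
    using assms by (simp add: gderiv_def)
  then have "((\<lambda>x. L / 2 * (x \<bullet> x) - f x) has_derivative
      (\<lambda>h. L / 2 * (x \<bullet> h + h \<bullet> x) - h \<bullet> D)) (at x)"
    by (intro has_derivative_diff has_derivative_mult_right has_derivative_inner has_derivative_ident)
  moreover have "(\<lambda>h. L / 2 * (x \<bullet> h + h \<bullet> x) - h \<bullet> D) = (\<lambda>h. h \<bullet> (L *\<^sub>R x - D))"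
  proof
    fix h
    show "L / 2 * (x \<bullet> h + h \<bullet> x) - h \<bullet> D = h \<bullet> (L *\<^sub>R x - D)"
      by (simp add: inner_commute[of x h] inner_diff_right)
  qed
  ultimately show ?thesis
    by (simp add: gderiv_def)
qed

lemma convex_quadratic_minus_iff_quadratic_upper_bound:
  assumes "\<And>x. GDERIV f x :> G x"
  shows "convex_quadratic_minus L f \<longleftrightarrow> quadratic_upper_bound L f G"
proof -
  have "(L / 2 * (y \<bullet> y) - f y) - (L / 2 * (x \<bullet> x) - f x + (L *\<^sub>R x - G x) \<bullet> (y - x))
      = (f x + G x \<bullet> (y - x) + L / 2 * (norm (y - x))\<^sup>2) - f y" for x y
    unfolding power2_norm_eq_inner
    by (simp add: inner_diff inner_commute[of y x] field_simps)
  then have "L / 2 * (y \<bullet> y) - f y \<ge> L / 2 * (x \<bullet> x) - f x + (L *\<^sub>R x - G x) \<bullet> (y - x)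
      \<longleftrightarrow> f y \<le> f x + G x \<bullet> (y - x) + L / 2 * (norm (y - x))\<^sup>2" for x y
    by (metis diff_ge_0_iff_ge)
  then show ?thesis
    unfolding convex_quadratic_minus_def quadratic_upper_bound_def
    using convex_on_iff_tangent[OF GDERIV_quadratic_minus[OF assms], of L] by simp
qed

lemma convex_quadratic_minus_iff_gradient_monotone_upper:
  assumes "\<And>x. GDERIV f x :> G x"
  shows "convex_quadratic_minus L f \<longleftrightarrow> gradient_monotone_upper L G"
proof -
  have "((L *\<^sub>R x - G x) - (L *\<^sub>R y - G y)) \<bullet> (x - y) \<ge> 0
      \<longleftrightarrow> (G x - G y) \<bullet> (x - y) \<le> L * (norm (x - y))\<^sup>2" for x y
    unfolding power2_norm_eq_inner by (simp add: inner_diff algebra_simps)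
  then show ?thesis
    unfolding convex_quadratic_minus_def gradient_monotone_upper_def
    using convex_on_iff_tangent[OF GDERIV_quadratic_minus[OF assms], of L]
      tangent_iff_gradient_monotone[OF GDERIV_quadratic_minus[OF assms], of L] by simp
qed

lemma convex_quadratic_minus_iff_jensen_lower:
  "convex_quadratic_minus L f \<longleftrightarrow> jensen_lower L f"
proof -
  have "(\<alpha> * (L / 2 * (norm x)\<^sup>2 - f x) + (1 - \<alpha>) * (L / 2 * (norm y)\<^sup>2 - f y))
      - (L / 2 * (norm (\<alpha> *\<^sub>R x + (1 - \<alpha>) *\<^sub>R y))\<^sup>2 - f (\<alpha> *\<^sub>R x + (1 - \<alpha>) *\<^sub>R y))
    = f (\<alpha> *\<^sub>R x + (1 - \<alpha>) *\<^sub>R y)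
      - (\<alpha> * f x + (1 - \<alpha>) * f y - \<alpha> * (1 - \<alpha>) * L / 2 * (norm (x - y))\<^sup>2)" for x y \<alpha>
    unfolding norm_sq_convex_combination by (simp add: field_simps)
  then have "L / 2 * (norm (\<alpha> *\<^sub>R x + (1 - \<alpha>) *\<^sub>R y))\<^sup>2 - f (\<alpha> *\<^sub>R x + (1 - \<alpha>) *\<^sub>R y)
      \<le> \<alpha> * (L / 2 * (norm x)\<^sup>2 - f x) + (1 - \<alpha>) * (L / 2 * (norm y)\<^sup>2 - f y)
    \<longleftrightarrow> f (\<alpha> *\<^sub>R x + (1 - \<alpha>) *\<^sub>R y)
      \<ge> \<alpha> * f x + (1 - \<alpha>) * f y - \<alpha> * (1 - \<alpha>) * L / 2 * (norm (x - y))\<^sup>2" for x y \<alpha>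
    by (metis diff_ge_0_iff_ge)
  then show ?thesis
    unfolding convex_quadratic_minus_def convex_on_UNIV_iff jensen_lower_def
      power2_norm_eq_inner[symmetric] by blast
qed

lemma lipschitz_gradient_imp_gradient_monotone_upper:
  assumes "lipschitz_gradient L G"
  shows "gradient_monotone_upper L G"
  unfolding gradient_monotone_upper_def
proof (intro allI)
  fix x y
  have "(G x - G y) \<bullet> (x - y) \<le> norm (G x - G y) * norm (x - y)"
    by (rule norm_cauchy_schwarz)
  also have "\<dots> \<le> L * norm (x - y) * norm (x - y)"
    using assms by (intro mult_right_mono) (auto simp: lipschitz_gradient_def)
  finally show "(G x - G y) \<bullet> (x - y) \<le> L * (norm (x - y))\<^sup>2"
    by (simp add: power2_eq_square)
qed

section \<open>Lower bounds by the gradient difference\<close>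

lemma gradient_lower_bound_iff_jensen_upper:
  assumes "\<And>x. GDERIV f x :> G x" and "L > 0"
  shows "gradient_lower_bound L f G \<longleftrightarrow> jensen_upper L f G"
  using tangent_iff_jensen[of f G "1 / (2 * L)"] assms
  by (simp add: gradient_lower_bound_def jensen_upper_def)

lemma gradient_lower_bound_imp_cocoercive:
  assumes "gradient_lower_bound L f G"
  shows "gradient_cocoercive L G"
  unfolding gradient_cocoercive_def
proof (intro allI)
  fix x y
  have "f y \<ge> f x + G x \<bullet> (y - x) + 1 / (2 * L) * (norm (G x - G y))\<^sup>2"
    "f x \<ge> f y + G y \<bullet> (x - y) + 1 / (2 * L) * (norm (G x - G y))\<^sup>2"
    using assms unfolding gradient_lower_bound_def by (metis norm_minus_commute, metis)
  moreover have "1 / L * (norm (G x - G y))\<^sup>2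
      = 1 / (2 * L) * (norm (G x - G y))\<^sup>2 + 1 / (2 * L) * (norm (G x - G y))\<^sup>2"
    by simp
  ultimately show "(G x - G y) \<bullet> (x - y) \<ge> 1 / L * (norm (G x - G y))\<^sup>2"
    unfolding inner_diff by linarith
qed

lemma cocoercive_imp_lipschitz_gradient:
  assumes "gradient_cocoercive L G" and "L > 0"
  shows "lipschitz_gradient L G"
  unfolding lipschitz_gradient_def
proof (intro allI)
  fix x y
  have "1 / L * (norm (G x - G y))\<^sup>2 \<le> (G x - G y) \<bullet> (x - y)"
    using assms by (simp add: gradient_cocoercive_def)
  also have "\<dots> \<le> norm (G x - G y) * norm (x - y)"
    by (rule norm_cauchy_schwarz)
  finally have "norm (G x - G y) * norm (G x - G y) \<le> norm (G x - G y) * (L * norm (x - y))"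
    using \<open>L > 0\<close> by (simp add: field_simps power2_eq_square)
  then show "norm (G x - G y) \<le> L * norm (x - y)"
    using \<open>L > 0\<close> by (cases "G x = G y") (simp_all add: mult_le_cancel_left)
qed

text \<open>The gap between the tangent plane at \<open>x\<close> and the paraboloid at \<open>y\<close> is smallest at
  \<open>z = y - (G y - G x) / L\<close>, a gradient step from \<open>y\<close> on \<open>f\<close> minus its tangent at \<open>x\<close>.  There the
  linear terms gain \<open>\<parallel>G y - G x\<parallel>\<^sup>2 / L\<close>, of which the quadratic term takes back half.\<close>

lemma gradient_lower_bound_if_convex:
  assumes gradient: "\<And>x. GDERIV f x :> G x" and "L > 0"
    and "convex_on UNIV f" and upper: "quadratic_upper_bound L f G"
  shows "gradient_lower_bound L f G"
  unfolding gradient_lower_bound_def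
proof (intro allI)
  fix x y
  define d where "d = G y - G x"
  define z where "z = y - (1 / L) *\<^sub>R d"
  have "f x + G x \<bullet> (z - x) \<le> f z"
    using convex_on_iff_tangent[OF gradient] \<open>convex_on UNIV f\<close> by blast
  also have "\<dots> \<le> f y + G y \<bullet> (z - y) + L / 2 * (norm (z - y))\<^sup>2"
    using upper by (simp add: quadratic_upper_bound_def)
  also have "L / 2 * (norm (z - y))\<^sup>2 = 1 / (2 * L) * (norm d)\<^sup>2"
    using \<open>L > 0\<close> by (simp add: z_def power2_eq_square field_simps)
  finally have "f y \<ge> f x + G x \<bullet> (y - x) + (d \<bullet> (y - z) - 1 / (2 * L) * (norm d)\<^sup>2)"
    by (simp add: d_def inner_diff)
  moreover have "d \<bullet> (y - z) = 1 / (2 * L) * (norm d)\<^sup>2 + 1 / (2 * L) * (norm d)\<^sup>2"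
    by (simp add: z_def power2_norm_eq_inner)
  ultimately show "f y \<ge> f x + G x \<bullet> (y - x) + 1 / (2 * L) * (norm (G y - G x))\<^sup>2"
    unfolding d_def by linarith
qed

section \<open>The equivalences\<close>

theorem lemma4:
  fixes f :: "real^'n \<Rightarrow> real" and G :: "real^'n \<Rightarrow> real^'n" and L :: real
  assumes gradient: "\<And>x. GDERIV f x :> G x"
    and lipschitz: "\<exists>M. M-lipschitz_on UNIV G"
    and L_pos: "L > 0"
  shows "(gradient_lower_bound L f G \<longleftrightarrow> jensen_upper L f G) \<and>
    (jensen_upper L f G \<longrightarrow> gradient_cocoercive L G) \<and>
    (gradient_cocoercive L G \<longrightarrow> lipschitz_gradient L G) \<and>
    (lipschitz_gradient L G \<longrightarrow> convex_quadratic_minus L f) \<and>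
    (convex_quadratic_minus L f \<longleftrightarrow> quadratic_upper_bound L f G) \<and>
    (quadratic_upper_bound L f G \<longleftrightarrow> gradient_monotone_upper L G) \<and>
    (gradient_monotone_upper L G \<longleftrightarrow> jensen_lower L f) \<and>
    (convex_on UNIV f \<longrightarrow>
      (lipschitz_gradient L G \<longleftrightarrow> convex_quadratic_minus L f) \<and>
      (lipschitz_gradient L G \<longleftrightarrow> quadratic_upper_bound L f G) \<and>
      (lipschitz_gradient L G \<longleftrightarrow> gradient_monotone_upper L G) \<and>
      (lipschitz_gradient L G \<longleftrightarrow> jensen_lower L f) \<and>
      (lipschitz_gradient L G \<longleftrightarrow> gradient_lower_bound L f G) \<and>
      (lipschitz_gradient L G \<longleftrightarrow> gradient_cocoercive L G) \<and>
      (lipschitz_gradient L G \<longleftrightarrow> jensen_upper L f G))"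
proof -
  have "gradient_lower_bound L f G \<longleftrightarrow> jensen_upper L f G"
    by (rule gradient_lower_bound_iff_jensen_upper[OF gradient L_pos])
  moreover have "gradient_lower_bound L f G \<Longrightarrow> gradient_cocoercive L G"
    by (rule gradient_lower_bound_imp_cocoercive)
  moreover have "gradient_cocoercive L G \<Longrightarrow> lipschitz_gradient L G"
    by (rule cocoercive_imp_lipschitz_gradient[OF _ L_pos])
  moreover have "lipschitz_gradient L G \<Longrightarrow> gradient_monotone_upper L G"
    by (rule lipschitz_gradient_imp_gradient_monotone_upper)
  moreover have "convex_quadratic_minus L f \<longleftrightarrow> gradient_monotone_upper L G"
    by (rule convex_quadratic_minus_iff_gradient_monotone_upper[OF gradient])
  moreover have "convex_quadratic_minus L f \<longleftrightarrow> quadratic_upper_bound L f G"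
    by (rule convex_quadratic_minus_iff_quadratic_upper_bound[OF gradient])
  moreover have "convex_quadratic_minus L f \<longleftrightarrow> jensen_lower L f"
    by (rule convex_quadratic_minus_iff_jensen_lower)
  moreover have "convex_on UNIV f \<Longrightarrow> quadratic_upper_bound L f G \<Longrightarrow> gradient_lower_bound L f G"
    by (rule gradient_lower_bound_if_convex[OF gradient L_pos])
  ultimately show ?thesis
    by argo
qed

end
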